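(* Let $\tau:\mathbb{U}\to\Omega$, $\tau(z)=\frac{az+b}{cz+d}$, be a linear fractional Riemann map, and let $\Phi$ be an analytic self-map of $\Omega$ such that $C_{\Phi}$ is a unitary bounded composition operator on $H^{2}(\Omega)$. (1) If $|c|^{2}=|d|^{2}$, then there is $r\in\mathbb{C}$ with $\mathrm{Re}(\overline{r}(b\overline{d}-a\overline{c}))=0$ such that $\Phi(w)=w+r$ for all $w\in\Omega$. (2) If $|c|^{2}\neq|d|^{2}$, then there is $r\in\mathbb{C}$ with $|r|=1$ such that $\Phi(w)=rw+\frac{(r-1)(b\overline{d}-a\overline{c})}{|c|^{2}-|d|^{2}}$ for all $w\in\Omega$. Conversely, suppose that either $|c|^2=|d|^2$ and $\Phi(w)=w+r$ with $r\in\mathbb{C}$, $\mathrm{Re}(\overline{r}(b\overline{d}-a\overline{c}))=0$, or $|c|^2\neq|d|^2$ and $\Phi(w)=rw+\frac{(r-1)(b\overline{d}-a\overline{c})}{|c|^{2}-|d|^{2}}$ with $r\in\mathbb{C}$, $|r|=1$. If $\Phi$ is a self-map of $\Omega$ such that $C_{\Phi}$ is invertible and bounded on $H^{2}(\Omega)$, then $C_{\Phi}$ is unitary.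
   Context: $\mathbb{U}$ is the open unit disc and $\Omega$ is an open simply connected proper subset of $\mathbb{C}$. A Riemann map $\tau:\mathbb{U}\to\Omega$ is a biholomorphic map of $\mathbb{U}$ onto $\Omega$; it is a linear fractional Riemann map if $\tau(z)=\frac{az+b}{cz+d}$ with $a,b,c,d\in\mathbb{C}$, $ad-bc\neq0$. The Hardy-Smirnov space $H^{2}(\Omega)$ is the set of analytic $f:\Omega\to\mathbb{C}$ with $\|f\|^{2}=\sup_{0<r<1}\frac{1}{2\pi}\int_{\Gamma_r}|f(w)|^{2}|dw|<\infty$, where $\Gamma_r=\tau(\{|z|=r\})$; the norm is the one induced by the given $\tau$. Fix an analytic branch of $(\tau')^{1/2}$ on $\mathbb{U}$. The map $Vf=(f\circ\tau)(\tau')^{1/2}$ is an isometric isomorphism from $H^2(\Omega)$ onto the classical Hardy space $H^2(\mathbb{U})$, and $H^{2}(\Omega)$ is a Hilbert space with inner product $\langle f,g\rangle=\langle Vf,Vg\rangle_{2}$, where $\langle\cdot,\cdot\rangle_2$ is the inner product of $H^2(\mathbb{U})$, $\langle F,G\rangle_2=\sum_{n\ge0}\widehat F(n)\overline{\widehat G(n)}$ (Maclaurin coefficients). For an analytic self-map $\Phi$ of $\Omega$, $C_{\Phi}f=f\circ\Phi$. A bounded operator $T$ is unitary if $TT^*=T^*T=Id$. *)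

theory Defs
  imports "HOL-Complex_Analysis.Complex_Analysis"
begin

definition riemann_map :: "(complex \<Rightarrow> complex) \<Rightarrow> complex set \<Rightarrow> bool" where
  "riemann_map \<tau> \<Omega> \<longleftrightarrow>
     \<tau> holomorphic_on ball 0 1 \<and> bij_betw \<tau> (ball 0 1) \<Omega> \<and>
     inv_into (ball 0 1) \<tau> holomorphic_on \<Omega>"

text \<open>
  Although division is total, holomorphy of \<open>\<tau>\<close> together with \<open>a * d - b * c \<noteq> 0\<close>
  forces \<open>c * z + d \<noteq> 0\<close> on the unit disc: near a zero of the denominator the quotient
  is unbounded.
\<close>

definition linear_fractional_riemann_map ::
    "(complex \<Rightarrow> complex) \<Rightarrow> complex set \<Rightarrow> complex \<Rightarrow> complex \<Rightarrow> complex \<Rightarrow> complex \<Rightarrow> bool" where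
  "linear_fractional_riemann_map \<tau> \<Omega> a b c d \<longleftrightarrow>
     riemann_map \<tau> \<Omega> \<and> a * d - b * c \<noteq> 0 \<and>
     (\<forall>z\<in>ball 0 1. \<tau> z = (a * z + b) / (c * z + d))"

definition sqrt_deriv_branch :: "(complex \<Rightarrow> complex) \<Rightarrow> (complex \<Rightarrow> complex) \<Rightarrow> bool" where
  "sqrt_deriv_branch \<tau> s \<longleftrightarrow>
     s holomorphic_on ball 0 1 \<and> (\<forall>z\<in>ball 0 1. (s z)\<^sup>2 = deriv \<tau> z)"

definition arclength_integral :: "(real \<Rightarrow> complex) \<Rightarrow> (complex \<Rightarrow> real) \<Rightarrow> real" where
  "arclength_integral \<gamma> u =
     integral {0..1} (\<lambda>t. u (\<gamma> t) * norm (vector_derivative \<gamma> (at t within {0..1})))"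

definition hs_mean :: "(complex \<Rightarrow> complex) \<Rightarrow> (complex \<Rightarrow> complex) \<Rightarrow> real \<Rightarrow> real" where
  "hs_mean \<tau> f r =
     1 / (2 * pi) * arclength_integral (\<tau> \<circ> circlepath 0 r) (\<lambda>w. (norm (f w))\<^sup>2)"

text \<open>
  A function on \<open>\<Omega>\<close> is represented by its extension by \<open>0\<close> to the whole plane, so that
  equality of elements of the space is equality of functions and the vector space
  operations are the pointwise ones.
\<close>

definition hardy_smirnov :: "complex set \<Rightarrow> (complex \<Rightarrow> complex) \<Rightarrow> (complex \<Rightarrow> complex) set" where
  "hardy_smirnov \<Omega> \<tau> =
     {f. f holomorphic_on \<Omega> \<and> (\<forall>w. w \<notin> \<Omega> \<longrightarrow> f w = 0) \<and>
         bdd_above (hs_mean \<tau> f ` {0<..<1})}"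

definition hs_norm :: "(complex \<Rightarrow> complex) \<Rightarrow> (complex \<Rightarrow> complex) \<Rightarrow> real" where
  "hs_norm \<tau> f = sqrt (SUP r\<in>{0<..<1}. hs_mean \<tau> f r)"

definition maclaurin_coeff :: "(complex \<Rightarrow> complex) \<Rightarrow> nat \<Rightarrow> complex" where
  "maclaurin_coeff F n = (deriv ^^ n) F 0 / fact n"

definition hardy_inner :: "(complex \<Rightarrow> complex) \<Rightarrow> (complex \<Rightarrow> complex) \<Rightarrow> complex" where
  "hardy_inner F G = (\<Sum>n. maclaurin_coeff F n * cnj (maclaurin_coeff G n))"

definition hs_transfer ::
    "(complex \<Rightarrow> complex) \<Rightarrow> (complex \<Rightarrow> complex) \<Rightarrow> (complex \<Rightarrow> complex) \<Rightarrow> complex \<Rightarrow> complex" where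
  "hs_transfer \<tau> s f = (\<lambda>z. f (\<tau> z) * s z)"

definition hs_inner ::
    "(complex \<Rightarrow> complex) \<Rightarrow> (complex \<Rightarrow> complex) \<Rightarrow> (complex \<Rightarrow> complex) \<Rightarrow> (complex \<Rightarrow> complex) \<Rightarrow> complex" where
  "hs_inner \<tau> s f g = hardy_inner (hs_transfer \<tau> s f) (hs_transfer \<tau> s g)"

definition composition_op ::
    "complex set \<Rightarrow> (complex \<Rightarrow> complex) \<Rightarrow> (complex \<Rightarrow> complex) \<Rightarrow> complex \<Rightarrow> complex" where
  "composition_op \<Omega> \<Phi> f = (\<lambda>w. if w \<in> \<Omega> then f (\<Phi> w) else 0)"

text \<open>
  Operators on the Hardy-Smirnov space are functions on the ambient function type;
  only their values on the space matter.
\<close>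

definition bounded_operator ::
    "complex set \<Rightarrow> (complex \<Rightarrow> complex) \<Rightarrow> ((complex \<Rightarrow> complex) \<Rightarrow> complex \<Rightarrow> complex) \<Rightarrow> bool" where
  "bounded_operator \<Omega> \<tau> T \<longleftrightarrow>
     (\<forall>f\<in>hardy_smirnov \<Omega> \<tau>. T f \<in> hardy_smirnov \<Omega> \<tau>) \<and>
     (\<forall>f\<in>hardy_smirnov \<Omega> \<tau>. \<forall>g\<in>hardy_smirnov \<Omega> \<tau>. \<forall>\<alpha> \<beta>.
        T (\<lambda>w. \<alpha> * f w + \<beta> * g w) = (\<lambda>w. \<alpha> * T f w + \<beta> * T g w)) \<and>
     (\<exists>K. \<forall>f\<in>hardy_smirnov \<Omega> \<tau>. hs_norm \<tau> (T f) \<le> K * hs_norm \<tau> f)"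

definition inverse_operators ::
    "complex set \<Rightarrow> (complex \<Rightarrow> complex) \<Rightarrow> ((complex \<Rightarrow> complex) \<Rightarrow> complex \<Rightarrow> complex)
      \<Rightarrow> ((complex \<Rightarrow> complex) \<Rightarrow> complex \<Rightarrow> complex) \<Rightarrow> bool" where
  "inverse_operators \<Omega> \<tau> T S \<longleftrightarrow>
     (\<forall>f\<in>hardy_smirnov \<Omega> \<tau>. T (S f) = f \<and> S (T f) = f)"

definition invertible_operator ::
    "complex set \<Rightarrow> (complex \<Rightarrow> complex) \<Rightarrow> ((complex \<Rightarrow> complex) \<Rightarrow> complex \<Rightarrow> complex) \<Rightarrow> bool" where
  "invertible_operator \<Omega> \<tau> T \<longleftrightarrow>
     bounded_operator \<Omega> \<tau> T \<and>
     (\<exists>S. bounded_operator \<Omega> \<tau> S \<and> inverse_operators \<Omega> \<tau> T S)"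

definition adjoint_operators ::
    "complex set \<Rightarrow> (complex \<Rightarrow> complex) \<Rightarrow> (complex \<Rightarrow> complex) \<Rightarrow> ((complex \<Rightarrow> complex) \<Rightarrow> complex \<Rightarrow> complex)
      \<Rightarrow> ((complex \<Rightarrow> complex) \<Rightarrow> complex \<Rightarrow> complex) \<Rightarrow> bool" where
  "adjoint_operators \<Omega> \<tau> s T S \<longleftrightarrow>
     (\<forall>f\<in>hardy_smirnov \<Omega> \<tau>. \<forall>g\<in>hardy_smirnov \<Omega> \<tau>.
        hs_inner \<tau> s (T f) g = hs_inner \<tau> s f (S g))"

text \<open>
  The witness \<open>S\<close> below is the adjoint of \<open>T\<close>, which is unique on the space, so the
  condition reads \<open>T T* = T* T = Id\<close>.
\<close>

definition unitary_operator ::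
    "complex set \<Rightarrow> (complex \<Rightarrow> complex) \<Rightarrow> (complex \<Rightarrow> complex)
      \<Rightarrow> ((complex \<Rightarrow> complex) \<Rightarrow> complex \<Rightarrow> complex) \<Rightarrow> bool" where
  "unitary_operator \<Omega> \<tau> s T \<longleftrightarrow>
     bounded_operator \<Omega> \<tau> T \<and>
     (\<exists>S. bounded_operator \<Omega> \<tau> S \<and> adjoint_operators \<Omega> \<tau> s T S \<and>
          inverse_operators \<Omega> \<tau> T S)"

end

theory Submission imports Defs begin

text \<open>
  Let \<open>\<iota>\<close> be the inverse of \<open>\<tau>\<close>. Carrying the Szegoe kernel of the disc over to \<open>\<Omega>\<close> makes
  the Hardy-Smirnov space a reproducing kernel space, and a unitary composition operator with symbol
  \<open>\<Phi>\<close> must preserve the kernel: \<open>k (\<Phi> v) (\<Phi> w) = k v w\<close>. For a linear fractional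
  \<open>\<tau>\<close> the kernel is \<open>\<bar>a d - b c\<bar> / Q w v\<close> with
  \<open>Q w v = (a - c w) cnj (a - c v) - (d w - b) cnj (d v - b)\<close>, a Hermitian form in
  \<open>(1, w)\<close> and \<open>(1, v)\<close> with leading coefficient \<open>\<bar>c\<bar>\<^sup>2 - \<bar>d\<bar>\<^sup>2\<close>. If this coefficient
  vanishes, invariance of \<open>Q\<close> is a linear condition that forces a translation; otherwise completing
  the square turns it into \<open>X (\<Phi> w) cnj (X (\<Phi> v)) = X w cnj (X v)\<close> for a shift \<open>X\<close> of the
  variable, which forces a rotation.

  Conversely, such maps preserve \<open>Q\<close>, hence also the region \<open>Q w w > 0\<close>, which is \<open>\<Omega>\<close>. So
  the inverse of the composition operator acts as its adjoint on the kernels, and by continuity on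
  the whole space.
\<close>

section \<open>Power series on the unit disc\<close>

lemma conv_radius_ge_1:
  fixes a :: "nat \<Rightarrow> complex"
  assumes "\<And>z. norm z < 1 \<Longrightarrow> (\<lambda>n. a n * z ^ n) sums F z"
  shows "1 \<le> conv_radius a"
proof (rule conv_radius_geI_ex)
  fix r :: real assume "0 < r" "ereal r < 1"
  then show "\<exists>z. norm z = r \<and> summable (\<lambda>n. a n * z ^ n)"
    using assms[of "of_real r"] by (intro exI[of _ "of_real r"]) (auto simp: sums_iff)
qed

text \<open>Uniqueness of power series coefficients. Every later computation of Maclaurin
  coefficients goes through this rule: it suffices to exhibit an expansion that converges on the
  disc.\<close>

lemma maclaurin_coeff_eqI:
  assumes "\<And>z. norm z < 1 \<Longrightarrow> (\<lambda>n. a n * z ^ n) sums F z"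
  shows "maclaurin_coeff F = a"
proof -
  have "1 \<le> conv_radius a" by (rule conv_radius_ge_1) (rule assms)
  then have "0 < conv_radius a" by (rule less_le_trans[rotated]) simp
  moreover have "eventually (\<lambda>z. z \<in> ball 0 1) (nhds (0::complex))"
    by (rule eventually_nhds_in_open) auto
  then have "\<forall>\<^sub>F z in nhds 0. eval_fps (Abs_fps a) z = F z"
    by eventually_elim (use assms in \<open>auto simp: eval_fps_def sums_iff\<close>)
  ultimately have "F has_fps_expansion Abs_fps a"
    by (auto simp: has_fps_expansion_def fps_conv_radius_def)
  from fps_nth_fps_expansion[OF this] show ?thesis
    by (auto simp: maclaurin_coeff_def)
qed

lemma maclaurin_sums:
  assumes "F holomorphic_on ball 0 1" "norm z < 1"
  shows "(\<lambda>n. maclaurin_coeff F n * z ^ n) sums F z"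
  using holomorphic_power_series[OF assms(1), of z] assms(2)
  by (simp add: maclaurin_coeff_def)

text \<open>Cauchy's formula for the \<open>n\<close>-th derivative at 0, rewritten on the circle:
  there \<open>cnj u = r\<^sup>2 / u\<close>, so the factor \<open>1 / u ^ n\<close> equals
  \<open>cnj u ^ n / r ^ (2 * n)\<close>. The remaining \<open>1 / u\<close> cancels against the
  derivative \<open>2 * pi * \<i> * u\<close> of the parametrisation.\<close>

lemma circle_coefficient_integral:
  assumes F: "F holomorphic_on ball 0 1" and r: "0 < r" "r < 1"
  shows "((\<lambda>t. F (circlepath 0 r t) * cnj (circlepath 0 r t) ^ n) has_integral
    maclaurin_coeff F n * of_real (r ^ (2 * n))) {0..1}"
proof -
  define \<gamma> where "\<gamma> = circlepath 0 r"
  have sub: "cball 0 r \<subseteq> ball (0::complex) 1" using r by auto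
  have "((\<lambda>u. F u / (u - 0) ^ Suc n) has_contour_integral
      (2 * pi * \<i>) / fact n * (deriv ^^ n) F 0) \<gamma>"
    unfolding \<gamma>_def
    using sub r by (intro Cauchy_has_contour_integral_higher_derivative_circlepath)
      (auto intro!: holomorphic_on_imp_continuous_on holomorphic_on_subset[OF F])
  then have "((\<lambda>t. of_real (r ^ (2 * n)) / (2 * pi * \<i>) * (F (\<gamma> t) / (\<gamma> t - 0) ^ Suc n *
      vector_derivative \<gamma> (at t within {0..1}))) has_integral
      of_real (r ^ (2 * n)) / (2 * pi * \<i>) * ((2 * pi * \<i>) / fact n * (deriv ^^ n) F 0)) {0..1}"
    unfolding has_contour_integral_def by (rule has_integral_mult_right)
  then have "((\<lambda>t. F (\<gamma> t) * cnj (\<gamma> t) ^ n) has_integral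
      of_real (r ^ (2 * n)) / (2 * pi * \<i>) * ((2 * pi * \<i>) / fact n * (deriv ^^ n) F 0)) {0..1}"
  proof (rule has_integral_eq[rotated])
    fix t :: real assume t: "t \<in> {0..1}"
    have g: "\<gamma> t = r * exp (2 * of_real pi * \<i> * t)" by (simp add: \<gamma>_def circlepath)
    have g0: "\<gamma> t \<noteq> 0" using g r by simp
    have "vector_derivative \<gamma> (at t within {0..1}) = 2 * pi * \<i> * \<gamma> t"
      using t g by (simp add: \<gamma>_def vector_derivative_circlepath01)
    moreover have "\<gamma> t * cnj (\<gamma> t) = of_real (r\<^sup>2)"
      unfolding complex_norm_square[symmetric] g using r by (simp add: norm_mult)
    then have "cnj (\<gamma> t) = of_real (r\<^sup>2) / \<gamma> t"
      using g0 by (simp add: field_simps)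
    then have "cnj (\<gamma> t) ^ n = of_real (r ^ (2 * n)) / \<gamma> t ^ n"
      by (simp add: power_divide power_mult)
    ultimately show "of_real (r ^ (2 * n)) / (2 * pi * \<i>) * (F (\<gamma> t) / (\<gamma> t - 0) ^ Suc n *
      vector_derivative \<gamma> (at t within {0..1})) = F (\<gamma> t) * cnj (\<gamma> t) ^ n"
      using g0 by (simp add: field_simps)
  qed
  then show ?thesis by (simp add: \<gamma>_def maclaurin_coeff_def mult.commute)
qed

text \<open>Multiply \<open>F\<close> by the conjugates of its Taylor partial sums and integrate
  term by term with the preceding formula. The partial sums converge uniformly on the circle, so the
  limit may be taken under the integral.\<close>

lemma circle_parseval:
  assumes F: "F holomorphic_on ball 0 1" and r: "0 < r" "r < 1"
  shows "(\<lambda>n. (cmod (maclaurin_coeff F n))\<^sup>2 * r ^ (2 * n)) sums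
    integral {0..1} (\<lambda>t. (cmod (F (circlepath 0 r t)))\<^sup>2)"
proof -
  define \<gamma> where "\<gamma> = circlepath 0 r"
  define a where "a = maclaurin_coeff F"
  have sub: "cball 0 r \<subseteq> ball (0::complex) 1" using r by auto
  have cont\<gamma>: "continuous_on {0..1} \<gamma>"
    unfolding \<gamma>_def circlepath by (intro continuous_intros)
  have \<gamma>: "\<gamma> \<in> {0..1} \<rightarrow> cball 0 r"
    using r by (auto simp: \<gamma>_def circlepath norm_mult)
  have contF: "continuous_on {0..1} (\<lambda>t. F (\<gamma> t))"
    using \<gamma> sub by (intro continuous_on_compose2[OF holomorphic_on_imp_continuous_on[OF F] cont\<gamma>]) auto
  have "1 \<le> conv_radius a"
    unfolding a_def by (rule conv_radius_ge_1) (rule maclaurin_sums[OF F])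
  then have "ereal r < conv_radius a" using r by (meson ereal_less(3) less_le_trans less_ereal.simps(1) one_ereal_def)
  from uniform_limit_compose'[OF powser_uniform_limit[OF this, of 0] \<gamma>]
  have "uniform_limit {0..1} (\<lambda>n t. \<Sum>i<n. a i * \<gamma> t ^ i) (\<lambda>t. suminf (\<lambda>i. a i * \<gamma> t ^ i)) sequentially"
    by simp
  moreover have "suminf (\<lambda>i. a i * \<gamma> t ^ i) = F (\<gamma> t)" if "t \<in> {0..1}" for t
  proof -
    have "\<gamma> t \<in> ball 0 1" using \<gamma> that sub by blast
    then have "cmod (\<gamma> t) < 1" by simp
    from maclaurin_sums[OF F this] show ?thesis by (simp add: a_def sums_iff)
  qed
  ultimately have "uniform_limit {0..1} (\<lambda>n t. \<Sum>i<n. a i * \<gamma> t ^ i) (\<lambda>t. F (\<gamma> t)) sequentially"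
    using uniform_limit_cong'[of "{0..1}" "\<lambda>n t. \<Sum>i<n. a i * \<gamma> t ^ i"
        "\<lambda>n t. \<Sum>i<n. a i * \<gamma> t ^ i" "\<lambda>t. \<Sum>i. a i * \<gamma> t ^ i" "\<lambda>t. F (\<gamma> t)"]
    by blast
  then have "uniform_limit {0..1} (\<lambda>n t. cnj (\<Sum>i<n. a i * \<gamma> t ^ i)) (\<lambda>t. cnj (F (\<gamma> t))) sequentially"
    by (rule bounded_linear.uniform_limit[OF bounded_linear_cnj])
  \<comment> \<open>A product of uniform limits needs bounded limit functions; here both are
    continuous on a compact interval.\<close>
  then have ul: "uniform_limit {0..1} (\<lambda>n t. F (\<gamma> t) * cnj (\<Sum>i<n. a i * \<gamma> t ^ i))
      (\<lambda>t. F (\<gamma> t) * cnj (F (\<gamma> t))) sequentially"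
    by (intro uniform_lim_mult uniform_limit_const)
       (auto intro!: compact_imp_bounded compact_continuous_image contF continuous_intros)
  have cn: "continuous_on {0..1} (\<lambda>t. F (\<gamma> t) * cnj (\<Sum>i<n. a i * \<gamma> t ^ i))" for n
    by (intro continuous_intros contF cont\<gamma>)
  obtain I J where I: "\<And>n. ((\<lambda>t. F (\<gamma> t) * cnj (\<Sum>i<n. a i * \<gamma> t ^ i)) has_integral I n) {0..1}"
    and J: "((\<lambda>t. F (\<gamma> t) * cnj (F (\<gamma> t))) has_integral J) {0..1}" and IJ: "I \<longlonglongrightarrow> J"
    using uniform_limit_integral[OF ul cn] by auto
  have "I n = (\<Sum>i<n. of_real ((cmod (a i))\<^sup>2 * r ^ (2 * i)))" for n
  proof -
    have "((\<lambda>t. \<Sum>i<n. cnj (a i) * (F (\<gamma> t) * cnj (\<gamma> t) ^ i)) has_integral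
        (\<Sum>i<n. cnj (a i) * (a i * of_real (r ^ (2 * i))))) {0..1}"
      unfolding \<gamma>_def a_def
      by (intro has_integral_sum has_integral_mult_right circle_coefficient_integral assms) auto
    also have "(\<lambda>t. \<Sum>i<n. cnj (a i) * (F (\<gamma> t) * cnj (\<gamma> t) ^ i)) =
        (\<lambda>t. F (\<gamma> t) * cnj (\<Sum>i<n. a i * \<gamma> t ^ i))"
      by (simp add: sum_distrib_left mult_ac)
    finally have "I n = (\<Sum>i<n. cnj (a i) * (a i * of_real (r ^ (2 * i))))"
      using I has_integral_unique by blast
    then show ?thesis
      by (simp add: complex_norm_square mult_ac flip: of_real_power)
  qed
  then have "I = (\<lambda>n. \<Sum>i<n. of_real ((cmod (a i))\<^sup>2 * r ^ (2 * i)))" by blast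
  then have "(\<lambda>n. of_real ((cmod (a n))\<^sup>2 * r ^ (2 * n))) sums J"
    using IJ unfolding sums_def by simp
  then have "(\<lambda>n. (cmod (a n))\<^sup>2 * r ^ (2 * n)) sums Re J"
    using sums_Re by fastforce
  moreover have "((\<lambda>t. Re (F (\<gamma> t) * cnj (F (\<gamma> t)))) has_integral Re J) {0..1}"
    by (rule has_integral_Re[OF J])
  then have "((\<lambda>t. (cmod (F (\<gamma> t)))\<^sup>2) has_integral Re J) {0..1}"
    unfolding complex_norm_square[symmetric] by (simp flip: of_real_power)
  ultimately show ?thesis
    by (simp add: integral_unique \<gamma>_def a_def)
qed

section \<open>Square-summable sequences\<close>

lemma Cauchy_Schwarz_suminf:
  fixes a b :: "nat \<Rightarrow> complex"
  assumes a: "summable (\<lambda>n. (cmod (a n))\<^sup>2)" and b: "summable (\<lambda>n. (cmod (b n))\<^sup>2)"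
  shows "summable (\<lambda>n. a n * b n)"
    and "cmod (\<Sum>n. a n * b n) \<le> sqrt (\<Sum>n. (cmod (a n))\<^sup>2) * sqrt (\<Sum>n. (cmod (b n))\<^sup>2)"
proof -
  let ?B = "sqrt (\<Sum>n. (cmod (a n))\<^sup>2) * sqrt (\<Sum>n. (cmod (b n))\<^sup>2)"
  have part: "(\<Sum>n<N. cmod (a n * b n)) \<le> ?B" for N
  proof -
    have "(\<Sum>n<N. cmod (a n * b n)) \<le> L2_set (\<lambda>n. cmod (a n)) {..<N} * L2_set (\<lambda>n. cmod (b n)) {..<N}"
      using L2_set_mult_ineq[of "\<lambda>n. cmod (a n)" "\<lambda>n. cmod (b n)" "{..<N}"] by (simp add: norm_mult)
    also have "\<dots> \<le> ?B"
      unfolding L2_set_def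
      by (intro mult_mono real_sqrt_le_mono sum_le_suminf a b) (auto intro!: sum_nonneg suminf_nonneg a)
    finally show ?thesis .
  qed
  have s: "summable (\<lambda>n. cmod (a n * b n))"
    \<comment> \<open>The summability criterion bounds sums over \<open>{..n}\<close>, which are the
      sums over \<open>{..<Suc n}\<close>.\<close>
    using part[of "Suc _"] by (intro bounded_imp_summable[where B = ?B]) (simp_all only: lessThan_Suc_atMost norm_ge_zero)
  then show "summable (\<lambda>n. a n * b n)" by (rule summable_norm_cancel)
  have "cmod (\<Sum>n. a n * b n) \<le> (\<Sum>n. cmod (a n * b n))" by (rule summable_norm[OF s])
  also have "\<dots> \<le> ?B" by (rule suminf_le_const[OF s part])
  finally show "cmod (\<Sum>n. a n * b n) \<le> ?B" .
qed

text \<open>Monotone convergence by hand: a finite partial sum of \<open>A\<close> is the limit, as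
  \<open>r\<close> tends to 1 from the left, of \<open>r\<close> times the damped partial sum, and
  the latter is at most \<open>r * S r\<close>. The extra factor \<open>r\<close> is the one that
  the length of a circle of radius \<open>r\<close> brings into the Hardy-Smirnov means.\<close>

lemma abel_mean_bounded:
  fixes A :: "nat \<Rightarrow> real"
  assumes A: "\<And>n. 0 \<le> A n"
    and S: "\<And>r. 0 < r \<Longrightarrow> r < 1 \<Longrightarrow> (\<lambda>n. A n * r ^ (2 * n)) sums S r"
    and B: "\<And>r. 0 < r \<Longrightarrow> r < 1 \<Longrightarrow> r * S r \<le> B"
  shows "summable A" and "suminf A \<le> B"
proof -
  have part: "(\<Sum>n<N. A n) \<le> B" for N
  proof -
    have "((\<lambda>r. r * (\<Sum>n<N. A n * r ^ (2 * n))) \<longlongrightarrow> 1 * (\<Sum>n<N. A n * 1 ^ (2 * n))) (at_left 1)"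
      by (intro tendsto_intros)
    moreover have "\<forall>\<^sub>F r in at_left 1. r * (\<Sum>n<N. A n * r ^ (2 * n)) \<le> B"
    proof -
      have "\<forall>\<^sub>F r in at_left 1. r \<in> {0<..<1::real}"
        by (rule eventually_at_left_real) simp
      then show ?thesis
      proof eventually_elim
        case (elim r)
        then have r: "0 < r" "r < 1" by auto
        have "(\<Sum>n<N. A n * r ^ (2 * n)) \<le> (\<Sum>n. A n * r ^ (2 * n))"
          using r A sums_summable[OF S[OF r]] by (intro sum_le_suminf) auto
        also have "\<dots> = S r" using S[OF r] by (simp add: sums_iff)
        finally have "r * (\<Sum>n<N. A n * r ^ (2 * n)) \<le> r * S r" using r by simp
        then show ?case using B[OF r] by simp
      qed
    qed
    ultimately show ?thesis using tendsto_upperbound[of _ _ "at_left (1::real)"] by force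
  qed
  show "summable A"
    using part[of "Suc _"] A by (intro bounded_imp_summable[where B = B]) (simp_all only: lessThan_Suc_atMost)
  then show "suminf A \<le> B" using part by (rule suminf_le_const)
qed

lemma abel_mean_le:
  fixes A :: "nat \<Rightarrow> real"
  assumes A: "\<And>n. 0 \<le> A n" and sA: "summable A"
    and r: "0 < r" "r < 1" and S: "(\<lambda>n. A n * r ^ (2 * n)) sums S"
  shows "r * S \<le> suminf A"
proof -
  have le: "A n * r ^ (2 * n) \<le> A n" for n
    using A r by (simp add: mult_left_le power_le_one)
  have "0 \<le> S" using S A r by (auto simp: sums_iff intro!: suminf_nonneg)
  then have "r * S \<le> S" using r by (simp add: mult_left_le_one_le)
  also have "S \<le> suminf A" using S le sA by (auto simp: sums_iff intro!: suminf_le)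
  finally show ?thesis .
qed

text \<open>This turns the definition of the space and of its norm, a supremum of integral means,
  into a statement about the sum of the squared coefficients.\<close>

lemma abel_mean_Sup:
  fixes A :: "nat \<Rightarrow> real"
  assumes A: "\<And>n. 0 \<le> A n"
    and S: "\<And>r. 0 < r \<Longrightarrow> r < 1 \<Longrightarrow> (\<lambda>n. A n * r ^ (2 * n)) sums S r"
  shows "bdd_above ((\<lambda>r. r * S r) ` {0<..<1}) \<longleftrightarrow> summable A"
    and "summable A \<Longrightarrow> (SUP r\<in>{0<..<1}. r * S r) = suminf A"
proof -
  have le: "r * S r \<le> suminf A" if "summable A" "r \<in> {0<..<1}" for r
    using that by (intro abel_mean_le[OF A _ _ _ S]) auto
  then have bdd: "bdd_above ((\<lambda>r. r * S r) ` {0<..<1})" if "summable A"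
    using that by (intro bdd_aboveI2[where M = "suminf A"])
  have "summable A" if B: "bdd_above ((\<lambda>r. r * S r) ` {0<..<1})"
    by (rule abel_mean_bounded(1)[OF A S, of "SUP r\<in>{0<..<1}. r * S r"])
       (auto intro!: cSUP_upper B)
  then show "bdd_above ((\<lambda>r. r * S r) ` {0<..<1}) \<longleftrightarrow> summable A"
    using bdd by (rule iffI)
  show "(SUP r\<in>{0<..<1}. r * S r) = suminf A" if "summable A"
  proof (rule antisym)
    show "(SUP r\<in>{0<..<1}. r * S r) \<le> suminf A"
      using le[OF that] by (intro cSUP_least) auto
    show "suminf A \<le> (SUP r\<in>{0<..<1}. r * S r)"
      by (rule abel_mean_bounded(2)[OF A S]) (auto intro!: cSUP_upper bdd that)
  qed
qed

section \<open>The Hardy-Smirnov space of a Riemann map\<close>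

locale hardy_smirnov_map =
  fixes \<Omega> :: "complex set" and \<tau> s :: "complex \<Rightarrow> complex"
  assumes riemann: "riemann_map \<tau> \<Omega>" and branch: "sqrt_deriv_branch \<tau> s"
begin

abbreviation \<iota> :: "complex \<Rightarrow> complex" where "\<iota> \<equiv> inv_into (ball 0 1) \<tau>"

abbreviation H :: "(complex \<Rightarrow> complex) set" where "H \<equiv> hardy_smirnov \<Omega> \<tau>"

abbreviation inner_HS :: "(complex \<Rightarrow> complex) \<Rightarrow> (complex \<Rightarrow> complex) \<Rightarrow> complex"
  where "inner_HS \<equiv> hs_inner \<tau> s"

text \<open>These coefficients identify the space isometrically with the square-summable sequences;
  all Hilbert space arguments below are carried out on them.\<close>

definition coef :: "(complex \<Rightarrow> complex) \<Rightarrow> nat \<Rightarrow> complex" where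
  "coef f = maclaurin_coeff (hs_transfer \<tau> s f)"

text \<open>The inverse of \<open>V = hs_transfer \<tau> s\<close>.\<close>

definition pull :: "(complex \<Rightarrow> complex) \<Rightarrow> complex \<Rightarrow> complex" where
  "pull F w = (if w \<in> \<Omega> then F (\<iota> w) / s (\<iota> w) else 0)"

lemma holomorphic_tau: "\<tau> holomorphic_on ball 0 1"
  and bij_tau: "bij_betw \<tau> (ball 0 1) \<Omega>"
  and holomorphic_inverse: "\<iota> holomorphic_on \<Omega>"
  and holomorphic_s: "s holomorphic_on ball 0 1"
  and s_square: "cmod z < 1 \<Longrightarrow> (s z)\<^sup>2 = deriv \<tau> z"
  using riemann branch by (auto simp: riemann_map_def sqrt_deriv_branch_def)

lemma tau_in [simp]: "cmod z < 1 \<Longrightarrow> \<tau> z \<in> \<Omega>"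
  using bij_tau by (auto simp: bij_betw_def)

lemma inverse_tau [simp]: "cmod z < 1 \<Longrightarrow> \<iota> (\<tau> z) = z"
  using bij_tau by (auto simp: bij_betw_def)

lemma tau_inverse [simp]: "w \<in> \<Omega> \<Longrightarrow> \<tau> (\<iota> w) = w"
  using bij_tau by (auto simp: bij_betw_def f_inv_into_f)

lemma inverse_in [simp]: "w \<in> \<Omega> \<Longrightarrow> cmod (\<iota> w) < 1"
  using bij_tau inv_into_into[of w \<tau> "ball 0 1"] by (auto simp: bij_betw_def)

text \<open>An injective holomorphic function has no critical points, and \<open>s\<close> squares
  to the derivative of \<open>\<tau>\<close>. This makes the division in \<open>pull\<close>
  legitimate.\<close>

lemma s_nonzero [simp]: "cmod z < 1 \<Longrightarrow> s z \<noteq> 0"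
  using holomorphic_injective_imp_regular[OF holomorphic_tau, of z] bij_tau s_square[of z]
  by (auto simp: bij_betw_def)

lemma holomorphic_transfer:
  assumes "f holomorphic_on \<Omega>"
  shows "hs_transfer \<tau> s f holomorphic_on ball 0 1"
proof -
  have "\<tau> ` ball 0 1 \<subseteq> \<Omega>" by auto
  from holomorphic_on_compose_gen[OF holomorphic_tau assms this] show ?thesis
    unfolding hs_transfer_def by (intro holomorphic_intros holomorphic_s) (simp add: o_def)
qed

lemma coef_sums:
  assumes "f holomorphic_on \<Omega>" "cmod z < 1"
  shows "(\<lambda>n. coef f n * z ^ n) sums (f (\<tau> z) * s z)"
  using maclaurin_sums[OF holomorphic_transfer[OF assms(1)] assms(2)]
  by (simp add: coef_def hs_transfer_def)

lemma coef_eqI: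
  assumes "\<And>z. cmod z < 1 \<Longrightarrow> (\<lambda>n. a n * z ^ n) sums (f (\<tau> z) * s z)"
  shows "coef f = a"
  unfolding coef_def by (rule maclaurin_coeff_eqI) (simp add: hs_transfer_def assms)

lemma coef_linear:
  assumes "f holomorphic_on \<Omega>" "g holomorphic_on \<Omega>"
  shows "coef (\<lambda>w. \<alpha> * f w + \<beta> * g w) = (\<lambda>n. \<alpha> * coef f n + \<beta> * coef g n)"
proof (rule coef_eqI)
  fix z :: complex assume z: "cmod z < 1"
  show "(\<lambda>n. (\<alpha> * coef f n + \<beta> * coef g n) * z ^ n) sums ((\<alpha> * f (\<tau> z) + \<beta> * g (\<tau> z)) * s z)"
    using sums_add[OF sums_mult[OF coef_sums[OF assms(1) z], of \<alpha>] sums_mult[OF coef_sums[OF assms(2) z], of \<beta>]]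
    by (simp add: algebra_simps)
qed

text \<open>Change of variables: along the image of the circle the arc length element is
  \<open>2 * pi * r * (cmod (s z))\<^sup>2\<close> times \<open>dt\<close>, because \<open>s\<close>
  squares to the derivative of \<open>\<tau>\<close>. So the mean of \<open>f\<close> is
  \<open>r\<close> times the square mean of its transfer to the disc, which Parseval's identity
  evaluates.\<close>

lemma hs_mean_sums:
  assumes f: "f holomorphic_on \<Omega>" and r: "0 < r" "r < 1"
  shows "\<exists>S. (\<lambda>n. (cmod (coef f n))\<^sup>2 * r ^ (2 * n)) sums S \<and> hs_mean \<tau> f r = r * S"
proof (intro exI conjI)
  define \<gamma> where "\<gamma> = circlepath 0 r"
  define I where "I = integral {0..1} (\<lambda>t. (cmod (hs_transfer \<tau> s f (\<gamma> t)))\<^sup>2)"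
  show "(\<lambda>n. (cmod (coef f n))\<^sup>2 * r ^ (2 * n)) sums I"
    unfolding coef_def I_def \<gamma>_def by (intro circle_parseval holomorphic_transfer f r)
  have "arclength_integral (\<tau> \<circ> \<gamma>) (\<lambda>w. (norm (f w))\<^sup>2) =
      integral {0..1} (\<lambda>t. (2 * pi * r) * (cmod (hs_transfer \<tau> s f (\<gamma> t)))\<^sup>2)"
    unfolding arclength_integral_def
  proof (rule integral_cong)
    fix t :: real assume t: "t \<in> {0..1}"
    have n: "cmod (\<gamma> t) < 1" using r by (simp add: \<gamma>_def circlepath norm_mult)
    have "(\<gamma> has_vector_derivative (2 * pi * \<i> * r * exp (2 * of_real pi * \<i> * t))) (at t)"
      unfolding \<gamma>_def by (rule has_vector_derivative_circlepath)
    moreover have "(\<tau> has_field_derivative deriv \<tau> (\<gamma> t)) (at (\<gamma> t))"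
      using n by (intro holomorphic_derivI[OF holomorphic_tau]) auto
    ultimately have "(\<tau> \<circ> \<gamma> has_vector_derivative
        (2 * pi * \<i> * r * exp (2 * of_real pi * \<i> * t)) * deriv \<tau> (\<gamma> t)) (at t)"
      by (rule field_vector_diff_chain_at)
    then have "vector_derivative (\<tau> \<circ> \<gamma>) (at t within {0..1}) =
        (2 * pi * \<i> * r * exp (2 * of_real pi * \<i> * t)) * deriv \<tau> (\<gamma> t)"
      by (rule vector_derivative_within_closed_interval[OF zero_less_one t has_vector_derivative_at_within])
    then have "cmod (vector_derivative (\<tau> \<circ> \<gamma>) (at t within {0..1})) = 2 * pi * r * (cmod (s (\<gamma> t)))\<^sup>2"
      using r unfolding s_square[OF n, symmetric] by (simp add: norm_mult norm_power)
    then show "(norm (f ((\<tau> \<circ> \<gamma>) t)))\<^sup>2 * norm (vector_derivative (\<tau> \<circ> \<gamma>) (at t within {0..1})) =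
      (2 * pi * r) * (cmod (hs_transfer \<tau> s f (\<gamma> t)))\<^sup>2"
      by (simp add: hs_transfer_def norm_mult power_mult_distrib)
  qed
  then show "hs_mean \<tau> f r = r * I"
    by (simp add: hs_mean_def I_def \<gamma>_def)
qed

lemma
  assumes f: "f holomorphic_on \<Omega>"
  shows bdd_above_hs_mean_iff:
      "bdd_above (hs_mean \<tau> f ` {0<..<1}) \<longleftrightarrow> summable (\<lambda>n. (cmod (coef f n))\<^sup>2)"
    and hs_norm_eq_sqrt_suminf:
      "summable (\<lambda>n. (cmod (coef f n))\<^sup>2) \<Longrightarrow> hs_norm \<tau> f = sqrt (\<Sum>n. (cmod (coef f n))\<^sup>2)"
proof -
  obtain S where S: "\<And>r. 0 < r \<Longrightarrow> r < 1 \<Longrightarrow> (\<lambda>n. (cmod (coef f n))\<^sup>2 * r ^ (2 * n)) sums S r"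
    and mean: "\<And>r. 0 < r \<Longrightarrow> r < 1 \<Longrightarrow> hs_mean \<tau> f r = r * S r"
    using hs_mean_sums[OF f] by metis
  have image: "hs_mean \<tau> f ` {0<..<1} = (\<lambda>r. r * S r) ` {0<..<1}"
    by (intro image_cong) (auto simp: mean)
  show "bdd_above (hs_mean \<tau> f ` {0<..<1}) \<longleftrightarrow> summable (\<lambda>n. (cmod (coef f n))\<^sup>2)"
    unfolding image by (rule abel_mean_Sup(1)[OF _ S]) auto
  show "summable (\<lambda>n. (cmod (coef f n))\<^sup>2) \<Longrightarrow> hs_norm \<tau> f = sqrt (\<Sum>n. (cmod (coef f n))\<^sup>2)"
    unfolding hs_norm_def image by (rule arg_cong[OF abel_mean_Sup(2)[OF _ S]]) auto
qed

lemma hardy_smirnov_iff: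
  "f \<in> H \<longleftrightarrow> f holomorphic_on \<Omega> \<and> (\<forall>w. w \<notin> \<Omega> \<longrightarrow> f w = 0) \<and> summable (\<lambda>n. (cmod (coef f n))\<^sup>2)"
  using bdd_above_hs_mean_iff by (auto simp: hardy_smirnov_def)

lemma
  assumes "f \<in> H"
  shows holomorphic_H: "f holomorphic_on \<Omega>"
    and summable_H: "summable (\<lambda>n. (cmod (coef f n))\<^sup>2)"
    and hs_norm_H: "hs_norm \<tau> f = sqrt (\<Sum>n. (cmod (coef f n))\<^sup>2)"
  using assms hs_norm_eq_sqrt_suminf by (auto simp: hardy_smirnov_iff)

lemma H_linear:
  assumes f: "f \<in> H" and g: "g \<in> H"
  shows "(\<lambda>w. \<alpha> * f w + \<beta> * g w) \<in> H"
  unfolding hardy_smirnov_iff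
proof (intro conjI)
  show "(\<lambda>w. \<alpha> * f w + \<beta> * g w) holomorphic_on \<Omega>"
    by (intro holomorphic_intros holomorphic_H f g)
  show "\<forall>w. w \<notin> \<Omega> \<longrightarrow> \<alpha> * f w + \<beta> * g w = 0"
    using f g by (simp add: hardy_smirnov_def)
  \<comment> \<open>The majorant comes from
    \<open>(x + y)\<^sup>2 \<le> 2 * x\<^sup>2 + 2 * y\<^sup>2\<close>.\<close>
  have "summable (\<lambda>n. (cmod (\<alpha> * coef f n + \<beta> * coef g n))\<^sup>2)"
  proof (rule summable_comparison_test')
    show "summable (\<lambda>n. 2 * (cmod \<alpha>)\<^sup>2 * (cmod (coef f n))\<^sup>2 + 2 * (cmod \<beta>)\<^sup>2 * (cmod (coef g n))\<^sup>2)"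
      by (intro summable_add summable_mult summable_H f g)
    fix n :: nat
    have "(cmod (\<alpha> * coef f n + \<beta> * coef g n))\<^sup>2 \<le> (cmod \<alpha> * cmod (coef f n) + cmod \<beta> * cmod (coef g n))\<^sup>2"
      by (intro power_mono norm_triangle_le) (auto simp: norm_mult)
    also have "\<dots> \<le> 2 * (cmod \<alpha> * cmod (coef f n))\<^sup>2 + 2 * (cmod \<beta> * cmod (coef g n))\<^sup>2"
      using sum_squares_bound[of "cmod \<alpha> * cmod (coef f n)" "cmod \<beta> * cmod (coef g n)"]
      by (simp add: power2_sum)
    finally show "norm ((cmod (\<alpha> * coef f n + \<beta> * coef g n))\<^sup>2) \<le>
        2 * (cmod \<alpha>)\<^sup>2 * (cmod (coef f n))\<^sup>2 + 2 * (cmod \<beta>)\<^sup>2 * (cmod (coef g n))\<^sup>2"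
      by (simp add: power_mult_distrib)
  qed
  then show "summable (\<lambda>n. (cmod (coef (\<lambda>w. \<alpha> * f w + \<beta> * g w) n))\<^sup>2)"
    using f g by (simp add: coef_linear holomorphic_H)
qed

lemma inner_HS_eq: "inner_HS f g = (\<Sum>n. coef f n * cnj (coef g n))"
  by (simp add: hs_inner_def hardy_inner_def coef_def)

lemma
  assumes f: "f \<in> H" and g: "g \<in> H"
  shows summable_inner_HS: "summable (\<lambda>n. coef f n * cnj (coef g n))"
    and cmod_inner_HS_le: "cmod (inner_HS f g) \<le> hs_norm \<tau> f * hs_norm \<tau> g"
  using Cauchy_Schwarz_suminf[of "coef f" "\<lambda>n. cnj (coef g n)"] f g
  by (auto simp: inner_HS_eq hs_norm_H summable_H)

lemma inner_HS_linear:
  assumes "f \<in> H" "g \<in> H" "h \<in> H"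
  shows "inner_HS (\<lambda>w. \<alpha> * f w + \<beta> * g w) h = \<alpha> * inner_HS f h + \<beta> * inner_HS g h"
proof -
  have "(\<lambda>n. \<alpha> * (coef f n * cnj (coef h n)) + \<beta> * (coef g n * cnj (coef h n))) sums
      (\<alpha> * inner_HS f h + \<beta> * inner_HS g h)"
    unfolding inner_HS_eq using assms by (intro sums_add sums_mult summable_sums summable_inner_HS)
  then show ?thesis
    using assms by (simp add: inner_HS_eq[of "\<lambda>w. _ w"] coef_linear holomorphic_H sums_iff algebra_simps)
qed

lemma transfer_pull: "cmod z < 1 \<Longrightarrow> pull F (\<tau> z) * s z = F z"
  by (simp add: pull_def)

text \<open>The surjectivity of the transfer to the disc: every square-summable sequence is the
  coefficient sequence of an element of the space. It supplies the monomials, the truncations and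
  the kernels.\<close>

lemma pull_in_H:
  assumes F: "\<And>z. cmod z < 1 \<Longrightarrow> (\<lambda>n. a n * z ^ n) sums F z"
    and a: "summable (\<lambda>n. (cmod (a n))\<^sup>2)"
  shows "coef (pull F) = a" and "pull F \<in> H"
proof -
  show coef: "coef (pull F) = a"
    by (rule coef_eqI) (simp only: transfer_pull F)
  have "F holomorphic_on ball 0 1"
    using F by (intro power_series_holomorphic[where a = a]) auto
  moreover have "\<iota> ` \<Omega> \<subseteq> ball 0 1" by auto
  ultimately have "(\<lambda>w. F (\<iota> w)) holomorphic_on \<Omega>" "(\<lambda>w. s (\<iota> w)) holomorphic_on \<Omega>"
    using holomorphic_on_compose_gen[OF holomorphic_inverse] holomorphic_s by (fastforce simp: o_def)+
  then have "(\<lambda>w. F (\<iota> w) / s (\<iota> w)) holomorphic_on \<Omega>"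
    by (intro holomorphic_intros) auto
  then have "pull F holomorphic_on \<Omega>"
    by (rule holomorphic_transform) (simp add: pull_def)
  then show "pull F \<in> H"
    using a by (simp add: hardy_smirnov_iff coef) (simp add: pull_def)
qed


section \<open>The monomial basis and expansions of bounded functionals\<close>

definition basis :: "nat \<Rightarrow> complex \<Rightarrow> complex" where
  "basis n = pull (\<lambda>z. z ^ n)"

definition truncation :: "(complex \<Rightarrow> complex) \<Rightarrow> nat \<Rightarrow> complex \<Rightarrow> complex" where
  "truncation f N = pull (\<lambda>z. \<Sum>n<N. coef f n * z ^ n)"

lemma basis_in_H: "basis n \<in> H"
  unfolding basis_def
proof (rule pull_in_H)
  show "(\<lambda>m. (if m = n then 1 else 0) * z ^ m) sums z ^ n" for z :: complex
    using sums_single[of n "\<lambda>m. z ^ m"] by (simp add: if_distrib[of "\<lambda>x. x * _"] cong: if_cong)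
  show "summable (\<lambda>m. (cmod (if m = n then 1 else 0))\<^sup>2)"
    by (rule summable_finite[of "{n}"]) auto
qed

lemma
  shows coef_truncation: "coef (truncation f N) = (\<lambda>n. if n < N then coef f n else 0)"
    and truncation_in_H: "truncation f N \<in> H"
proof -
  have sums: "(\<lambda>n. (if n < N then coef f n else 0) * z ^ n) sums (\<Sum>n<N. coef f n * z ^ n)" for z
    using sums_If_finite_set[of "{..<N}" "\<lambda>n. coef f n * z ^ n"]
    by (simp add: if_distrib[of "\<lambda>x. x * _"] cong: if_cong)
  have summable: "summable (\<lambda>n. (cmod (if n < N then coef f n else 0))\<^sup>2)"
    by (rule summable_finite[of "{..<N}"]) auto
  show "coef (truncation f N) = (\<lambda>n. if n < N then coef f n else 0)" "truncation f N \<in> H"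
    unfolding truncation_def by (rule pull_in_H[OF sums summable])+
qed

text \<open>The odd shape, with its zero coefficients here and the factor 1 in
  \<open>truncation_Suc\<close>, matches the two-term linear combinations for which linearity of a
  functional is assumed.\<close>

lemma truncation_0: "truncation f 0 = (\<lambda>w. 0 * basis 0 w + 0 * basis 0 w)"
  by (auto simp: truncation_def pull_def)

lemma truncation_Suc: "truncation f (Suc N) = (\<lambda>w. 1 * truncation f N w + coef f N * basis N w)"
  by (auto simp: truncation_def basis_def pull_def add_divide_distrib)

text \<open>The squared norm of the error is the tail of the convergent series of squared
  coefficients.\<close>

lemma truncation_tendsto:
  assumes f: "f \<in> H"
  shows "(\<lambda>N. hs_norm \<tau> (\<lambda>w. 1 * f w + (-1) * truncation f N w)) \<longlonglongrightarrow> 0"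
proof -
  let ?A = "\<lambda>n. (cmod (coef f n))\<^sup>2"
  have eq: "hs_norm \<tau> (\<lambda>w. 1 * f w + (-1) * truncation f N w) = sqrt (suminf ?A - (\<Sum>n<N. ?A n))" for N
  proof -
    have "coef (\<lambda>w. 1 * f w + (-1) * truncation f N w) =
        (\<lambda>n. 1 * coef f n + (-1) * coef (truncation f N) n)"
      by (intro coef_linear holomorphic_H f truncation_in_H)
    also have "\<dots> = (\<lambda>n. coef f n - (if n < N then coef f n else 0))"
      by (simp add: coef_truncation)
    finally have "(cmod (coef (\<lambda>w. 1 * f w + (-1) * truncation f N w) n))\<^sup>2 =
        ?A n - (if n \<in> {..<N} then ?A n else 0)" for n
      by simp
    moreover have "(\<lambda>n. ?A n - (if n \<in> {..<N} then ?A n else 0)) sums (suminf ?A - (\<Sum>n<N. ?A n))"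
      by (intro sums_diff summable_sums summable_H f sums_If_finite_set) auto
    ultimately show ?thesis
      unfolding hs_norm_H[OF H_linear[OF f truncation_in_H]] by (simp only: sums_iff)
  qed
  have "(\<lambda>N. sqrt (suminf ?A - (\<Sum>n<N. ?A n))) \<longlonglongrightarrow> sqrt (suminf ?A - suminf ?A)"
    by (intro tendsto_intros summable_LIMSEQ summable_H f)
  then show ?thesis unfolding eq by simp
qed

text \<open>Linearity gives the value on each truncation as a partial sum; boundedness lets the
  truncations tend to \<open>f\<close> inside \<open>D\<close>.\<close>

lemma functional_expansion:
  assumes linear: "\<And>f g \<alpha> \<beta>. f \<in> H \<Longrightarrow> g \<in> H \<Longrightarrow> D (\<lambda>w. \<alpha> * f w + \<beta> * g w) = \<alpha> * D f + \<beta> * D g"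
    and bounded: "\<And>f. f \<in> H \<Longrightarrow> cmod (D f) \<le> C * hs_norm \<tau> f"
    and f: "f \<in> H"
  shows "(\<lambda>n. coef f n * D (basis n)) sums D f"
proof -
  have part: "(\<Sum>n<N. coef f n * D (basis n)) = D (truncation f N)" for N
  proof (induction N)
    case 0
    show ?case unfolding truncation_0 by (subst linear) (auto intro: basis_in_H)
  next
    case (Suc N)
    have "D (truncation f (Suc N)) = 1 * D (truncation f N) + coef f N * D (basis N)"
      unfolding truncation_Suc by (intro linear truncation_in_H basis_in_H)
    then show ?case using Suc by simp
  qed
  have "(\<lambda>N. D (truncation f N) - D f) \<longlonglongrightarrow> 0"
  proof (rule Lim_null_comparison)
    show "(\<lambda>N. C * hs_norm \<tau> (\<lambda>w. 1 * f w + (-1) * truncation f N w)) \<longlonglongrightarrow> 0"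
      using tendsto_mult_left[OF truncation_tendsto[OF f], of C] by simp
    have "cmod (D (truncation f N) - D f) \<le> C * hs_norm \<tau> (\<lambda>w. 1 * f w + (-1) * truncation f N w)" for N
      using bounded[OF H_linear[OF f truncation_in_H], of 1 "-1" f N]
      unfolding linear[OF f truncation_in_H, of 1 "-1" f N] by (simp add: norm_minus_commute)
    then show "\<forall>\<^sub>F N in sequentially. cmod (D (truncation f N) - D f) \<le>
        C * hs_norm \<tau> (\<lambda>w. 1 * f w + (-1) * truncation f N w)"
      by simp
  qed
  then show ?thesis
    unfolding sums_def part by (simp add: LIM_zero_iff)
qed

section \<open>The reproducing kernel\<close>

text \<open>The Szegoe kernel of the disc at \<open>\<iota> v\<close>, carried over to
  \<open>\<Omega>\<close>. The factor \<open>1 / cnj (s (\<iota> v))\<close> compensates for the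
  weight in the transfer, so that pairing yields \<open>f v\<close> itself.\<close>

definition kernel :: "complex \<Rightarrow> complex \<Rightarrow> complex" where
  "kernel v = pull (\<lambda>z. 1 / (cnj (s (\<iota> v)) * (1 - cnj (\<iota> v) * z)))"

lemma kernel_eq:
  "w \<in> \<Omega> \<Longrightarrow> kernel v w = 1 / (s (\<iota> w) * cnj (s (\<iota> v)) * (1 - \<iota> w * cnj (\<iota> v)))"
  by (simp add: kernel_def pull_def mult_ac)

lemma kernel_outside: "w \<notin> \<Omega> \<Longrightarrow> kernel v w = 0"
  by (simp add: kernel_def pull_def)

lemma kernel_commute: "v \<in> \<Omega> \<Longrightarrow> w \<in> \<Omega> \<Longrightarrow> cnj (kernel v w) = kernel w v"
  by (simp add: kernel_eq mult_ac)

lemma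
  assumes v: "v \<in> \<Omega>"
  shows coef_kernel: "coef (kernel v) = (\<lambda>n. cnj (\<iota> v) ^ n / cnj (s (\<iota> v)))"
    and kernel_in_H: "kernel v \<in> H"
proof -
  have sums: "(\<lambda>n. cnj (\<iota> v) ^ n / cnj (s (\<iota> v)) * z ^ n) sums (1 / (cnj (s (\<iota> v)) * (1 - cnj (\<iota> v) * z)))"
    if "cmod z < 1" for z
  proof -
    have "cmod (cnj (\<iota> v) * z) < 1"
      using that v mult_strict_mono'[of "cmod (\<iota> v)" 1 "cmod z" 1] by (simp add: norm_mult)
    from sums_divide[OF geometric_sums[OF this], of "cnj (s (\<iota> v))"] show ?thesis
      by (simp add: power_mult_distrib mult_ac)
  qed
  have "(cmod (\<iota> v))\<^sup>2 < 1" using v by (simp add: abs_square_less_1)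
  then have "summable (\<lambda>n. ((cmod (\<iota> v))\<^sup>2) ^ n / (cmod (s (\<iota> v)))\<^sup>2)"
    by (intro summable_divide summable_geometric) simp
  then have summable: "summable (\<lambda>n. (cmod (cnj (\<iota> v) ^ n / cnj (s (\<iota> v))))\<^sup>2)"
    by (simp add: norm_divide norm_power power_divide mult.commute flip: power_mult)
  show "coef (kernel v) = (\<lambda>n. cnj (\<iota> v) ^ n / cnj (s (\<iota> v)))" "kernel v \<in> H"
    unfolding kernel_def by (rule pull_in_H[OF sums summable]; assumption)+
qed

text \<open>Pairing with the geometric coefficients of the kernel sums the Taylor series of the
  transferred function at \<open>\<iota> v\<close>; dividing by \<open>s (\<iota> v)\<close> leaves
  \<open>f v\<close>.\<close>

lemma
  assumes f: "f \<in> H" and v: "v \<in> \<Omega>"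
  shows inner_HS_kernel: "inner_HS f (kernel v) = f v"
    and inner_kernel_HS: "inner_HS (kernel v) f = cnj (f v)"
proof -
  have "(\<lambda>n. coef f n * \<iota> v ^ n / s (\<iota> v)) sums (f (\<tau> (\<iota> v)) * s (\<iota> v) / s (\<iota> v))"
    using v f by (intro sums_divide coef_sums holomorphic_H) auto
  then have sums: "(\<lambda>n. coef f n * cnj (coef (kernel v) n)) sums f v"
    using v by (simp add: coef_kernel)
  then show "inner_HS f (kernel v) = f v"
    by (simp add: inner_HS_eq sums_iff)
  show "inner_HS (kernel v) f = cnj (f v)"
    using sums_cnj[THEN iffD2, OF sums] by (simp add: inner_HS_eq sums_iff mult.commute)
qed

text \<open>
  The kernels span a dense subspace: up to a factor, \<open>kernel (\<tau> (cnj z))\<close> is the generating function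
  \<open>\<Sum>n. z ^ n * basis n\<close>, so a functional that vanishes on all kernels vanishes on the basis.
\<close>

lemma functional_eq_0:
  assumes linear: "\<And>f g \<alpha> \<beta>. f \<in> H \<Longrightarrow> g \<in> H \<Longrightarrow> D (\<lambda>w. \<alpha> * f w + \<beta> * g w) = \<alpha> * D f + \<beta> * D g"
    and bounded: "\<And>f. f \<in> H \<Longrightarrow> cmod (D f) \<le> C * hs_norm \<tau> f"
    and kernel: "\<And>v. v \<in> \<Omega> \<Longrightarrow> D (kernel v) = 0"
    and f: "f \<in> H"
  shows "D f = 0"
proof -
  have expansion: "(\<lambda>n. coef f n * D (basis n)) sums D f" if "f \<in> H" for f
    using linear bounded that by (rule functional_expansion)
  \<comment> \<open>The numbers \<open>D (basis n)\<close> turn out to be coefficients of the zero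
    function. Evaluating at the kernel of \<open>\<tau> (cnj z)\<close> makes the expansion
    holomorphic in \<open>z\<close>, since the kernel coefficients contain the conjugate of the
    point.\<close>
  have "maclaurin_coeff (\<lambda>_. 0) = (\<lambda>n. D (basis n))"
  proof (rule maclaurin_coeff_eqI)
    fix z :: complex assume z: "cmod z < 1"
    then have v: "\<tau> (cnj z) \<in> \<Omega>" by simp
    have "(\<lambda>n. z ^ n / cnj (s (cnj z)) * D (basis n)) sums 0"
      using expansion[OF kernel_in_H[OF v]] z kernel[OF v] coef_kernel[OF v] by simp
    from sums_mult[OF this, of "cnj (s (cnj z))"] show "(\<lambda>n. D (basis n) * z ^ n) sums 0"
      using z by (simp add: mult_ac)
  qed
  moreover have "maclaurin_coeff (\<lambda>_. 0) = (\<lambda>n. 0)"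
    by (rule maclaurin_coeff_eqI) simp
  ultimately have "D (basis n) = 0" for n by metis
  then have "(\<lambda>n. 0) sums D f" using expansion[OF f] by simp
  then show ?thesis by (rule sums_unique2[OF _ sums_zero])
qed

section \<open>Unitary composition operators and invariance of the kernel\<close>

text \<open>Evaluate \<open>T (S (kernel v)) = kernel v\<close> at \<open>w\<close>. The left side
  is the value of \<open>S (kernel v)\<close> at \<open>\<Phi> w\<close>, hence a pairing with
  \<open>kernel (\<Phi> w)\<close>; the adjoint relation moves \<open>S\<close> to the other side,
  where it becomes composition with \<open>\<Phi>\<close>.\<close>

lemma unitary_composition_kernel:
  assumes \<Phi>: "\<Phi> ` \<Omega> \<subseteq> \<Omega>" and unitary: "unitary_operator \<Omega> \<tau> s (composition_op \<Omega> \<Phi>)"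
    and v: "v \<in> \<Omega>" and w: "w \<in> \<Omega>"
  shows "kernel (\<Phi> v) (\<Phi> w) = kernel v w"
proof -
  define T where "T = composition_op \<Omega> \<Phi>"
  obtain S where bT: "bounded_operator \<Omega> \<tau> T" and bS: "bounded_operator \<Omega> \<tau> S"
    and adj: "adjoint_operators \<Omega> \<tau> s T S" and TS: "inverse_operators \<Omega> \<tau> T S"
    using unitary by (auto simp: unitary_operator_def T_def)
  have T: "T f \<in> H" and S: "S f \<in> H" and TS: "T (S f) = f" if "f \<in> H" for f
    using that bT bS TS by (auto simp: bounded_operator_def inverse_operators_def)
  have adj: "inner_HS (T f) g = inner_HS f (S g)" if "f \<in> H" "g \<in> H" for f g
    using that adj by (simp add: adjoint_operators_def)
  have \<Phi>v: "\<Phi> v \<in> \<Omega>" and \<Phi>w: "\<Phi> w \<in> \<Omega>" using \<Phi> v w by auto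
  note kH = kernel_in_H[OF v] kernel_in_H[OF \<Phi>w]
  have "kernel v w = T (S (kernel v)) w" by (simp add: TS kH)
  also have "\<dots> = S (kernel v) (\<Phi> w)" by (simp add: T_def composition_op_def w)
  \<comment> \<open>The adjoint relation has \<open>S\<close> in the second slot, so the value is
    written as a conjugated pairing with the kernel in the first.\<close>
  also have "\<dots> = cnj (inner_HS (kernel (\<Phi> w)) (S (kernel v)))"
    by (simp add: inner_kernel_HS S kH \<Phi>w)
  also have "\<dots> = cnj (inner_HS (T (kernel (\<Phi> w))) (kernel v))" by (simp add: adj kH)
  also have "\<dots> = cnj (kernel (\<Phi> w) (\<Phi> v))"
    by (simp add: inner_HS_kernel T kH v) (simp add: T_def composition_op_def v)
  finally show ?thesis using \<Phi>v \<Phi>w by (simp add: kernel_commute)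
qed

text \<open>The inverse \<open>S\<close> is shown to be the adjoint. For fixed \<open>g\<close>, the
  defect \<open>D\<close> in the adjoint relation is a bounded linear functional, so it is enough
  that it vanishes on kernels. As \<open>\<Phi>\<close> is onto, each kernel has the form
  \<open>kernel (\<Phi> u)\<close>; composition with \<open>\<Phi>\<close> turns it into
  \<open>kernel u\<close>, and both pairings equal \<open>cnj (g u)\<close>.\<close>

lemma composition_unitaryI:
  assumes onto: "\<Phi> ` \<Omega> = \<Omega>"
    and kernel: "\<And>v w. v \<in> \<Omega> \<Longrightarrow> w \<in> \<Omega> \<Longrightarrow> kernel (\<Phi> v) (\<Phi> w) = kernel v w"
    and inv: "invertible_operator \<Omega> \<tau> (composition_op \<Omega> \<Phi>)"
  shows "unitary_operator \<Omega> \<tau> s (composition_op \<Omega> \<Phi>)"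
proof -
  define T where "T = composition_op \<Omega> \<Phi>"
  obtain S where bT: "bounded_operator \<Omega> \<tau> T" and bS: "bounded_operator \<Omega> \<tau> S"
    and TS: "inverse_operators \<Omega> \<tau> T S"
    using inv by (auto simp: invertible_operator_def T_def)
  have T: "T f \<in> H" and S: "S f \<in> H" if "f \<in> H" for f
    using that bT bS by (auto simp: bounded_operator_def)
  obtain K where K: "\<And>f. f \<in> H \<Longrightarrow> hs_norm \<tau> (T f) \<le> K * hs_norm \<tau> f"
    using bT unfolding bounded_operator_def by blast
  have "inner_HS (T f) g = inner_HS f (S g)" if f: "f \<in> H" and g: "g \<in> H" for f g
  proof -
    define D where "D f = inner_HS (T f) g - inner_HS f (S g)" for f
    have "D f = 0"
    proof (rule functional_eq_0[of D, OF _ _ _ f])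
      fix f1 f2 \<alpha> \<beta> assume f12: "f1 \<in> H" "f2 \<in> H"
      have "T (\<lambda>w. \<alpha> * f1 w + \<beta> * f2 w) = (\<lambda>w. \<alpha> * T f1 w + \<beta> * T f2 w)"
        using bT f12 by (simp add: bounded_operator_def)
      then show "D (\<lambda>w. \<alpha> * f1 w + \<beta> * f2 w) = \<alpha> * D f1 + \<beta> * D f2"
        using f12 g by (simp add: D_def inner_HS_linear T S algebra_simps)
    next
      fix h assume h: "h \<in> H"
      have g0: "0 \<le> hs_norm \<tau> g" using g by (simp add: hs_norm_H suminf_nonneg summable_H)
      have "cmod (D h) \<le> cmod (inner_HS (T h) g) + cmod (inner_HS h (S g))"
        unfolding D_def by (rule norm_triangle_ineq4)
      also have "\<dots> \<le> hs_norm \<tau> (T h) * hs_norm \<tau> g + hs_norm \<tau> h * hs_norm \<tau> (S g)"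
        by (intro add_mono cmod_inner_HS_le T S g h)
      also have "\<dots> \<le> (K * hs_norm \<tau> h) * hs_norm \<tau> g + hs_norm \<tau> h * hs_norm \<tau> (S g)"
        by (intro add_mono mult_right_mono K h g0 order_refl)
      finally show "cmod (D h) \<le> (K * hs_norm \<tau> g + hs_norm \<tau> (S g)) * hs_norm \<tau> h"
        by (simp add: algebra_simps)
    next
      fix v assume "v \<in> \<Omega>"
      then obtain u where u: "u \<in> \<Omega>" and v: "v = \<Phi> u" using onto by blast
      have v\<Omega>: "\<Phi> u \<in> \<Omega>" using u onto by blast
      \<comment> \<open>On \<open>\<Omega>\<close> this is the invariance of the kernel; elsewhere
        both sides are 0 by the convention of extending by zero.\<close>
      have "T (kernel v) = kernel u"
        using u onto by (auto simp: T_def composition_op_def kernel kernel_outside v)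
      then have "inner_HS (T (kernel v)) g = cnj (g u)" using g u by (simp add: inner_kernel_HS)
      also have "g u = T (S g) u" using TS g by (simp add: inverse_operators_def)
      also have "\<dots> = S g v" using u by (simp add: T_def composition_op_def v)
      also have "cnj (S g v) = inner_HS (kernel v) (S g)"
        using g v\<Omega> by (simp add: inner_kernel_HS S v)
      finally show "D (kernel v) = 0" by (simp add: D_def)
    qed
    then show ?thesis by (simp add: D_def)
  qed
  then have "adjoint_operators \<Omega> \<tau> s T S" by (simp add: adjoint_operators_def)
  then show ?thesis using bT bS TS by (auto simp: unitary_operator_def T_def)
qed

end

section \<open>Linear fractional Riemann maps\<close>

locale linear_fractional_hardy_smirnov = hardy_smirnov_map +
  fixes a b c d :: complex
  assumes linear_fractional: "linear_fractional_riemann_map \<tau> \<Omega> a b c d"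
begin

definition \<Delta> :: complex where "\<Delta> = a * d - b * c"

definition \<beta> :: complex where "\<beta> = b * cnj d - a * cnj c"

text \<open>The inverse of \<open>\<tau>\<close> is \<open>(d * w - b) / (a - c * w)\<close>;
  \<open>Q\<close> is the disc expression \<open>1 - z * cnj \<zeta>\<close> in these coordinates
  with denominators cleared.\<close>

definition Q :: "complex \<Rightarrow> complex \<Rightarrow> complex" where
  "Q w v = (a - c * w) * cnj (a - c * v) - (d * w - b) * cnj (d * v - b)"

lemma Delta_nonzero: "\<Delta> \<noteq> 0"
  using linear_fractional by (simp add: \<Delta>_def linear_fractional_riemann_map_def)

lemma tau_eq: "cmod z < 1 \<Longrightarrow> \<tau> z = (a * z + b) / (c * z + d)"
  using linear_fractional by (simp add: linear_fractional_riemann_map_def)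

text \<open>Division by zero returns 0, so the formula for \<open>\<tau>\<close> alone does not
  exclude a pole. Continuity does: the identity \<open>\<tau> x * (c * x + d) = a * x + b\<close>
  holds near a zero \<open>z\<close> of the denominator and passes to the limit, so the numerator
  vanishes at \<open>z\<close> too and the determinant is 0.\<close>

lemma denominator_nonzero:
  assumes z: "cmod z < 1"
  shows "c * z + d \<noteq> 0"
proof
  assume zero: "c * z + d = 0"
  have "isCont \<tau> z"
    using z holomorphic_on_imp_continuous_on[OF holomorphic_tau]
    by (simp add: continuous_on_eq_continuous_at)
  then have "((\<lambda>x. \<tau> x * (c * x + d) - (a * x + b)) \<longlongrightarrow> \<tau> z * (c * z + d) - (a * z + b)) (at z)"
    by (intro tendsto_intros) (simp add: isCont_def)
  moreover have "\<forall>\<^sub>F x in at z. x \<in> ball 0 1 - {z}"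
    using z by (intro eventually_at_in_open) auto
  then have "\<forall>\<^sub>F x in at z. \<tau> x * (c * x + d) - (a * x + b) = 0"
  proof eventually_elim
    case (elim x)
    have "c \<noteq> 0" using zero Delta_nonzero by (auto simp: \<Delta>_def)
    moreover have "c * x + d = c * (x - z)" using zero by (simp add: algebra_simps eq_neg_iff_add_eq_0)
    ultimately show ?case using elim by (simp add: tau_eq)
  qed
  then have "((\<lambda>x. \<tau> x * (c * x + d) - (a * x + b)) \<longlongrightarrow> 0) (at z)"
    by (rule tendsto_eventually)
  ultimately have "\<tau> z * (c * z + d) - (a * z + b) = 0"
    by (intro tendsto_unique[OF _ _ ]) auto
  then have "a * z + b = 0" unfolding zero by (simp add: add_eq_0_iff)
  then have "b = - (a * z)" "d = - (c * z)" using zero by (simp_all add: add_eq_0_iff)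
  then have "a * d - b * c = 0" by simp
  then show False using Delta_nonzero by (simp add: \<Delta>_def)
qed

lemma linear_forms_tau:
  assumes z: "cmod z < 1"
  shows "a - c * \<tau> z = \<Delta> / (c * z + d)" and "d * \<tau> z - b = z * \<Delta> / (c * z + d)"
  using denominator_nonzero[OF z] by (simp_all add: tau_eq[OF z] \<Delta>_def field_simps)

lemma deriv_tau:
  assumes z: "cmod z < 1"
  shows "deriv \<tau> z = \<Delta> / (c * z + d)\<^sup>2"
proof (rule DERIV_imp_deriv, rule has_field_derivative_transform_within_open[where S = "ball 0 1"])
  show "((\<lambda>z. (a * z + b) / (c * z + d)) has_field_derivative \<Delta> / (c * z + d)\<^sup>2) (at z)"
    using denominator_nonzero[OF z]
    by (auto intro!: derivative_eq_intros simp: \<Delta>_def power2_eq_square algebra_simps)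
qed (use z in \<open>auto simp: tau_eq\<close>)

text \<open>The function \<open>s z * (c * z + d)\<close> takes only the two square roots of
  \<open>\<Delta>\<close> as values; being continuous on a connected set, it is constant. Which root
  it is does not affect the kernel, where only \<open>\<sigma> * cnj \<sigma>\<close>
  occurs.\<close>

lemma s_linear_fractional:
  obtains \<sigma> where "\<And>z. cmod z < 1 \<Longrightarrow> s z = \<sigma> / (c * z + d)" "\<sigma>\<^sup>2 = \<Delta>"
proof -
  have square: "(s z * (c * z + d))\<^sup>2 = \<Delta>" if "cmod z < 1" for z
    using that denominator_nonzero[OF that] by (simp add: power_mult_distrib s_square deriv_tau)
  have "(\<lambda>z. s z * (c * z + d)) constant_on ball 0 1"
  proof (rule continuous_finite_range_constant)
    show "continuous_on (ball 0 1) (\<lambda>z. s z * (c * z + d))"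
      by (intro continuous_intros holomorphic_on_imp_continuous_on holomorphic_s)
    have "(\<lambda>z. s z * (c * z + d)) ` ball 0 1 \<subseteq> {x. x\<^sup>2 = \<Delta>}"
      using square by auto
    also have "{x. x\<^sup>2 = \<Delta>} \<subseteq> {csqrt \<Delta>, - csqrt \<Delta>}"
      using power2_eq_iff[of _ "csqrt \<Delta>"] by auto
    finally show "finite ((\<lambda>z. s z * (c * z + d)) ` ball 0 1)"
      by (rule finite_subset) simp
  qed simp
  then obtain \<sigma> where \<sigma>: "\<And>z. cmod z < 1 \<Longrightarrow> s z * (c * z + d) = \<sigma>"
    by (auto simp: constant_on_def)
  show ?thesis
  proof
    show "s z = \<sigma> / (c * z + d)" if "cmod z < 1" for z
      using \<sigma>[OF that] denominator_nonzero[OF that] by (simp add: field_simps)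
    show "\<sigma>\<^sup>2 = \<Delta>" using square[of 0] \<sigma>[of 0] by simp
  qed
qed

text \<open>With \<open>p\<close> and \<open>q\<close> the two denominators, \<open>Q w v\<close> is
  \<open>(cmod \<Delta>)\<^sup>2 * (1 - z * cnj \<zeta>) / (p * q)\<close>, while the kernel is
  \<open>p * q / (cmod \<Delta> * (1 - z * cnj \<zeta>))\<close>, because
  \<open>\<sigma> * cnj \<sigma>\<close> has the value \<open>cmod \<Delta>\<close>.\<close>

lemma kernel_Q:
  assumes v: "v \<in> \<Omega>" and w: "w \<in> \<Omega>"
  shows "kernel v w = cmod \<Delta> / Q w v"
proof -
  define z \<zeta> where "z = \<iota> w" and "\<zeta> = \<iota> v"
  have z: "cmod z < 1" and \<zeta>: "cmod \<zeta> < 1" and "w = \<tau> z" "v = \<tau> \<zeta>"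
    using v w by (simp_all add: z_def \<zeta>_def)
  define p q where "p = c * z + d" and "q = cnj (c * \<zeta> + d)"
  have pq: "p \<noteq> 0" "q \<noteq> 0"
    using denominator_nonzero[OF z] denominator_nonzero[OF \<zeta>] by (auto simp: p_def q_def simp del: complex_cnj_add complex_cnj_mult)
  obtain \<sigma> where \<sigma>: "\<And>z. cmod z < 1 \<Longrightarrow> s z = \<sigma> / (c * z + d)" "\<sigma>\<^sup>2 = \<Delta>"
    using s_linear_fractional by blast
  have norm_\<sigma>: "\<sigma> * cnj \<sigma> = cmod \<Delta>"
    using complex_norm_square[of \<sigma>] by (simp add: norm_power flip: \<sigma>(2))
  have norm_\<Delta>: "\<Delta> * cnj \<Delta> = cmod \<Delta> * cmod \<Delta>"
    by (simp flip: complex_norm_square add: power2_eq_square)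
  have "Q w v = (\<Delta> / p) * (cnj \<Delta> / q) - (z * \<Delta> / p) * (cnj \<zeta> * cnj \<Delta> / q)"
    unfolding Q_def \<open>w = \<tau> z\<close> \<open>v = \<tau> \<zeta>\<close> linear_forms_tau[OF z] linear_forms_tau[OF \<zeta>]
    by (simp add: p_def q_def)
  also have "\<dots> = (\<Delta> * cnj \<Delta>) * (1 - z * cnj \<zeta>) / (p * q)"
    by (simp add: diff_divide_distrib algebra_simps)
  finally have "Q w v = cmod \<Delta> * cmod \<Delta> * (1 - z * cnj \<zeta>) / (p * q)"
    unfolding norm_\<Delta> .
  moreover have "kernel v w = 1 / ((\<sigma> / p) * (cnj \<sigma> / q) * (1 - z * cnj \<zeta>))"
    unfolding kernel_eq[OF w] z_def[symmetric] \<zeta>_def[symmetric] \<sigma>(1)[OF z] \<sigma>(1)[OF \<zeta>]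
    by (simp add: p_def q_def)
  then have "kernel v w = p * q / ((\<sigma> * cnj \<sigma>) * (1 - z * cnj \<zeta>))"
    by simp
  ultimately show ?thesis
    using Delta_nonzero pq unfolding norm_\<sigma> by simp
qed

text \<open>With total division, dividing a fixed nonzero number by \<open>x\<close> is injective in
  \<open>x\<close>, even at 0, so the values of \<open>Q\<close> can be compared directly.\<close>

lemma kernel_eq_iff_Q:
  assumes "v \<in> \<Omega>" "w \<in> \<Omega>" "v' \<in> \<Omega>" "w' \<in> \<Omega>"
  shows "kernel v w = kernel v' w' \<longleftrightarrow> Q w v = Q w' v'"
  using assms Delta_nonzero by (simp add: kernel_Q)

text \<open>The inequality says that \<open>(d * w - b) / (a - c * w)\<close>, the preimage of
  \<open>w\<close> under the linear fractional map, lies in the unit disc; its strictness keeps the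
  denominator away from 0.\<close>

lemma in_Omega_iff: "w \<in> \<Omega> \<longleftrightarrow> cmod (d * w - b) < cmod (a - c * w)"
proof
  assume "w \<in> \<Omega>"
  then obtain z where z: "cmod z < 1" and w: "w = \<tau> z"
    using tau_inverse inverse_in by metis
  show "cmod (d * w - b) < cmod (a - c * w)"
    unfolding w linear_forms_tau[OF z]
    using z Delta_nonzero denominator_nonzero[OF z]
    by (simp add: norm_divide norm_mult divide_strict_right_mono)
next
  assume less: "cmod (d * w - b) < cmod (a - c * w)"
  define z where "z = (d * w - b) / (a - c * w)"
  have nz: "a - c * w \<noteq> 0" using less by auto
  have z: "cmod z < 1" using less nz by (simp add: z_def norm_divide)
  have "a * z + b = w * \<Delta> / (a - c * w)" "c * z + d = \<Delta> / (a - c * w)"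
    using nz by (simp_all add: z_def \<Delta>_def field_simps)
  then have "\<tau> z = w" using z nz Delta_nonzero by (simp add: tau_eq)
  then show "w \<in> \<Omega>" using tau_in[OF z] by simp
qed

lemma Q_diagonal: "Q w w = of_real ((cmod (a - c * w))\<^sup>2 - (cmod (d * w - b))\<^sup>2)"
  unfolding Q_def of_real_diff complex_norm_square ..

text \<open>Membership in \<open>\<Omega>\<close> is positivity of \<open>Q\<close> on the diagonal,
  so it depends only on the diagonal value.\<close>

lemma in_Omega_Q:
  assumes "Q u u = Q w w" "w \<in> \<Omega>"
  shows "u \<in> \<Omega>"
proof -
  have "(cmod (a - c * u))\<^sup>2 - (cmod (d * u - b))\<^sup>2 = (cmod (a - c * w))\<^sup>2 - (cmod (d * w - b))\<^sup>2"
    using assms(1) unfolding Q_diagonal of_real_eq_iff .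
  moreover have "(cmod (d * w - b))\<^sup>2 < (cmod (a - c * w))\<^sup>2"
    using assms(2) unfolding in_Omega_iff by (intro power_strict_mono) auto
  ultimately have "(cmod (d * u - b))\<^sup>2 < (cmod (a - c * u))\<^sup>2" by linarith
  then show ?thesis unfolding in_Omega_iff by (rule power_less_imp_less_base) simp
qed

lemma Q_expand:
  "Q w v = (a * cnj a - b * cnj b) + w * cnj \<beta> + cnj v * \<beta> +
     of_real ((cmod c)\<^sup>2 - (cmod d)\<^sup>2) * w * cnj v"
  unfolding Q_def \<beta>_def of_real_diff complex_norm_square by (simp add: algebra_simps)

text \<open>Under this assumption \<open>c * \<beta>\<close> equals
  \<open>- \<Delta> * cnj d\<close>, and \<open>d\<close> is the denominator of
  \<open>\<tau>\<close> at 0.\<close>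

lemma beta_nonzero:
  assumes "(cmod c)\<^sup>2 = (cmod d)\<^sup>2"
  shows "\<beta> \<noteq> 0"
proof -
  have "c * \<beta> = b * c * cnj d - a * (c * cnj c)" by (simp add: \<beta>_def algebra_simps)
  also have "c * cnj c = d * cnj d" using assms by (simp flip: complex_norm_square)
  finally have "c * \<beta> = - \<Delta> * cnj d" by (simp add: \<Delta>_def algebra_simps)
  moreover have "d \<noteq> 0" using denominator_nonzero[of 0] by simp
  ultimately show ?thesis using Delta_nonzero by auto
qed

lemma Q_complete_square:
  fixes N :: real
  assumes N: "N = (cmod c)\<^sup>2 - (cmod d)\<^sup>2" "N \<noteq> 0"
  shows "Q w v = (a * cnj a - b * cnj b) - \<beta> * cnj \<beta> / N + N * (w + \<beta> / N) * cnj (v + \<beta> / N)"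
  unfolding Q_expand N(1)[symmetric] using N(2) by (simp add: field_simps)

lemma Omega_nonempty: "\<tau> 0 \<in> \<Omega>"
  by simp

section \<open>Maps that preserve the Hermitian form\<close>

text \<open>Without the term in \<open>w * cnj v\<close>, invariance of \<open>Q\<close> says
  \<open>h w + cnj (h v) = 0\<close> for all \<open>v\<close> and \<open>w\<close>. Hence
  \<open>h\<close> is constant and purely imaginary, and dividing by \<open>cnj \<beta>\<close>
  gives the translation vector.\<close>

lemma Q_preserving_translation:
  assumes Q: "\<And>v w. v \<in> \<Omega> \<Longrightarrow> w \<in> \<Omega> \<Longrightarrow> Q (\<Phi> w) (\<Phi> v) = Q w v"
    and cd: "(cmod c)\<^sup>2 = (cmod d)\<^sup>2"
  shows "\<exists>r. Re (cnj r * \<beta>) = 0 \<and> (\<forall>w\<in>\<Omega>. \<Phi> w = w + r)"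
proof -
  define h where "h w = (\<Phi> w - w) * cnj \<beta>" for w
  have h: "h w + cnj (h v) = 0" if "v \<in> \<Omega>" "w \<in> \<Omega>" for v w
    using Q[OF that] unfolding Q_expand cd by (simp add: h_def algebra_simps)
  define r where "r = h (\<tau> 0) / cnj \<beta>"
  have "h (\<tau> 0) + cnj (h (\<tau> 0)) = 0" using h Omega_nonempty by blast
  then have "Re (h (\<tau> 0)) = 0" by (simp add: complex_eq_iff)
  moreover have "cnj r * \<beta> = cnj (h (\<tau> 0))" using beta_nonzero[OF cd] by (simp add: r_def)
  ultimately have "Re (cnj r * \<beta>) = 0" by simp
  moreover have "\<Phi> w = w + r" if "w \<in> \<Omega>" for w
  proof -
    have "h w = h (\<tau> 0)"
      using h[OF Omega_nonempty that] h[OF Omega_nonempty Omega_nonempty] by (metis add_right_cancel)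
    then have "\<Phi> w - w = r" using beta_nonzero[OF cd] by (simp add: r_def h_def)
    then show ?thesis by (simp add: algebra_simps)
  qed
  ultimately show ?thesis by blast
qed

text \<open>In the shifted variable \<open>x\<close>, invariance of \<open>Q\<close> becomes
  invariance of \<open>x w * cnj (x v)\<close>. Fixing \<open>v\<close> with
  \<open>x v \<noteq> 0\<close>, the diagonal case shows that \<open>x (\<Phi> v)\<close> has the
  same modulus as \<open>x v\<close>, and the general case then makes \<open>x (\<Phi> w)\<close> a
  fixed unimodular multiple of \<open>x w\<close>.\<close>

lemma Q_preserving_rotation:
  assumes Q: "\<And>v w. v \<in> \<Omega> \<Longrightarrow> w \<in> \<Omega> \<Longrightarrow> Q (\<Phi> w) (\<Phi> v) = Q w v"
    and cd: "(cmod c)\<^sup>2 \<noteq> (cmod d)\<^sup>2"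
  shows "\<exists>r. cmod r = 1 \<and>
    (\<forall>w\<in>\<Omega>. \<Phi> w = r * w + (r - 1) * \<beta> / of_real ((cmod c)\<^sup>2 - (cmod d)\<^sup>2))"
proof -
  define N where "N = (cmod c)\<^sup>2 - (cmod d)\<^sup>2"
  have N: "N \<noteq> 0" using cd by (simp add: N_def)
  define x where "x w = w + \<beta> / N" for w
  have x: "x (\<Phi> w) * cnj (x (\<Phi> v)) = x w * cnj (x v)" if "v \<in> \<Omega>" "w \<in> \<Omega>" for v w
    using Q[OF that] N unfolding Q_complete_square[OF N_def N] x_def by simp
  \<comment> \<open>The shift \<open>x\<close> vanishes at a single point, whereas
    \<open>\<Omega>\<close> contains the two distinct points \<open>\<tau> 0\<close> and
    \<open>\<tau> (1/2)\<close>.\<close>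
  have "\<exists>v\<in>\<Omega>. x v \<noteq> 0"
  proof (rule ccontr)
    assume "\<not> ?thesis"
    then have "x (\<tau> 0) = 0" "x (\<tau> (1/2)) = 0" by auto
    then have "\<tau> 0 = \<tau> (1/2)" by (simp add: x_def add_eq_0_iff)
    then have "\<iota> (\<tau> 0) = \<iota> (\<tau> (1/2))" by simp
    then show False by simp
  qed
  then obtain v where v: "v \<in> \<Omega>" "x v \<noteq> 0" by blast
  have "cmod (x (\<Phi> v)) * cmod (x (\<Phi> v)) = cmod (x v) * cmod (x v)"
    using arg_cong[OF x[OF v(1) v(1)], of cmod] by (simp add: norm_mult)
  then have norm: "cmod (x (\<Phi> v)) = cmod (x v)" by (simp add: power2_eq_iff_nonneg flip: power2_eq_square)
  then have nz: "x (\<Phi> v) \<noteq> 0" using v(2) by auto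
  define r where "r = cnj (x v / x (\<Phi> v))"
  have "cmod r = 1" using norm v(2) by (simp add: r_def norm_divide)
  moreover have "\<Phi> w = r * w + (r - 1) * \<beta> / N" if w: "w \<in> \<Omega>" for w
  proof -
    have "x (\<Phi> w) = r * x w"
      using x[OF v(1) w] nz by (simp add: r_def field_simps)
    then show ?thesis by (simp add: x_def diff_divide_distrib algebra_simps)
  qed
  ultimately show ?thesis unfolding N_def by blast
qed

text \<open>The translation changes \<open>Q\<close> by
  \<open>r * cnj \<beta> + cnj r * \<beta>\<close>, which is twice the real part assumed to
  vanish.\<close>

lemma Q_translation:
  assumes "(cmod c)\<^sup>2 = (cmod d)\<^sup>2" "Re (cnj r * \<beta>) = 0"
  shows "Q (w + r) (v + r) = Q w v"
proof -
  have "r * cnj \<beta> + cnj r * \<beta> = 0"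
    using assms(2) by (simp add: complex_eq_iff algebra_simps)
  then show ?thesis
    unfolding Q_expand assms(1) by (simp add: algebra_simps)
qed

text \<open>The affine map is the rotation by \<open>r\<close> about \<open>- \<beta> / N\<close>,
  the centre of the completed square.\<close>

lemma Q_rotation:
  fixes N :: real
  assumes N: "N = (cmod c)\<^sup>2 - (cmod d)\<^sup>2" "N \<noteq> 0" and r: "cmod r = 1"
  shows "Q (r * w + (r - 1) * \<beta> / N) (r * v + (r - 1) * \<beta> / N) = Q w v"
proof -
  have shift: "r * u + (r - 1) * \<beta> / N + \<beta> / N = r * (u + \<beta> / N)" for u
    by (simp add: diff_divide_distrib algebra_simps)
  have "r * cnj r = 1" using r by (simp flip: complex_norm_square)
  then have "(r * x) * cnj (r * y) = x * cnj y" for x y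
    by (metis complex_cnj_mult mult.assoc mult.left_commute mult_1)
  then show ?thesis
    unfolding Q_complete_square[OF N] shift by (simp only: mult.assoc)
qed

text \<open>The map \<open>L\<close> extends \<open>\<Phi>\<close> to the whole plane. A preimage
  under \<open>L\<close> of a point of \<open>\<Omega>\<close> has the same diagonal value of
  \<open>Q\<close> and so lies in \<open>\<Omega>\<close>; thus \<open>\<Phi>\<close> maps
  \<open>\<Omega>\<close> onto itself.\<close>

lemma Q_preserving_unitary:
  assumes Q: "\<And>v w. Q (L w) (L v) = Q w v" and surj: "surj L"
    and \<Phi>: "\<And>w. w \<in> \<Omega> \<Longrightarrow> \<Phi> w = L w" and self: "\<Phi> ` \<Omega> \<subseteq> \<Omega>"
    and inv: "invertible_operator \<Omega> \<tau> (composition_op \<Omega> \<Phi>)"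
  shows "unitary_operator \<Omega> \<tau> s (composition_op \<Omega> \<Phi>)"
proof (rule composition_unitaryI[OF _ _ inv])
  have "w \<in> \<Phi> ` \<Omega>" if "w \<in> \<Omega>" for w
  proof -
    obtain u where u: "w = L u" using surj by (auto simp: surj_def)
    then have "u \<in> \<Omega>" using in_Omega_Q[of u w] Q[of u u] that by simp
    then show ?thesis using u \<Phi> by auto
  qed
  then show "\<Phi> ` \<Omega> = \<Omega>" using self by blast
  fix v w assume vw: "v \<in> \<Omega>" "w \<in> \<Omega>"
  then have "\<Phi> v \<in> \<Omega>" "\<Phi> w \<in> \<Omega>" using self by auto
  then show "kernel (\<Phi> v) (\<Phi> w) = kernel v w"
    using vw Q \<Phi> by (simp add: kernel_eq_iff_Q)
qed

end

theorem theorem4p7: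
  fixes \<Omega> :: "complex set" and \<tau> s :: "complex \<Rightarrow> complex" and a b c d :: complex
  assumes "open \<Omega>" and "simply_connected \<Omega>" and "\<Omega> \<noteq> UNIV"
    and "linear_fractional_riemann_map \<tau> \<Omega> a b c d"
    and "sqrt_deriv_branch \<tau> s"
  shows
    "(\<forall>\<Phi> :: complex \<Rightarrow> complex.
        \<Phi> holomorphic_on \<Omega> \<and> \<Phi> ` \<Omega> \<subseteq> \<Omega> \<and>
        unitary_operator \<Omega> \<tau> s (composition_op \<Omega> \<Phi>) \<longrightarrow>
          ((cmod c)\<^sup>2 = (cmod d)\<^sup>2 \<longrightarrow>
             (\<exists>r::complex. Re (cnj r * (b * cnj d - a * cnj c)) = 0 \<and>
                (\<forall>w\<in>\<Omega>. \<Phi> w = w + r))) \<and>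
          ((cmod c)\<^sup>2 \<noteq> (cmod d)\<^sup>2 \<longrightarrow>
             (\<exists>r::complex. cmod r = 1 \<and>
                (\<forall>w\<in>\<Omega>. \<Phi> w = r * w +
                   (r - 1) * (b * cnj d - a * cnj c) / of_real ((cmod c)\<^sup>2 - (cmod d)\<^sup>2))))) \<and>
     (\<forall>(\<Phi> :: complex \<Rightarrow> complex) (r::complex).
        ((cmod c)\<^sup>2 = (cmod d)\<^sup>2 \<and> Re (cnj r * (b * cnj d - a * cnj c)) = 0 \<and>
           (\<forall>w\<in>\<Omega>. \<Phi> w = w + r) \<or>
         (cmod c)\<^sup>2 \<noteq> (cmod d)\<^sup>2 \<and> cmod r = 1 \<and>
           (\<forall>w\<in>\<Omega>. \<Phi> w = r * w +
              (r - 1) * (b * cnj d - a * cnj c) / of_real ((cmod c)\<^sup>2 - (cmod d)\<^sup>2))) \<and>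
        \<Phi> ` \<Omega> \<subseteq> \<Omega> \<and>
        bounded_operator \<Omega> \<tau> (composition_op \<Omega> \<Phi>) \<and>
        invertible_operator \<Omega> \<tau> (composition_op \<Omega> \<Phi>) \<longrightarrow>
          unitary_operator \<Omega> \<tau> s (composition_op \<Omega> \<Phi>))"
proof -
  interpret linear_fractional_hardy_smirnov \<Omega> \<tau> s a b c d
    using assms(4,5) by unfold_locales (auto simp: linear_fractional_riemann_map_def)
  show ?thesis
    unfolding \<beta>_def[symmetric]
  proof (intro conjI allI impI; elim conjE)
    fix \<Phi> :: "complex \<Rightarrow> complex"
    assume \<Phi>: "\<Phi> ` \<Omega> \<subseteq> \<Omega>" and unitary: "unitary_operator \<Omega> \<tau> s (composition_op \<Omega> \<Phi>)"
    have Q: "Q (\<Phi> w) (\<Phi> v) = Q w v" if "v \<in> \<Omega>" "w \<in> \<Omega>" for v w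
    proof -
      have "\<Phi> v \<in> \<Omega>" "\<Phi> w \<in> \<Omega>" using that \<Phi> by auto
      then show ?thesis
        using unitary_composition_kernel[OF \<Phi> unitary that] that by (simp add: kernel_eq_iff_Q)
    qed
    show "\<exists>r. Re (cnj r * \<beta>) = 0 \<and> (\<forall>w\<in>\<Omega>. \<Phi> w = w + r)" if "(cmod c)\<^sup>2 = (cmod d)\<^sup>2"
      by (rule Q_preserving_translation[OF Q that])
    show "\<exists>r. cmod r = 1 \<and>
        (\<forall>w\<in>\<Omega>. \<Phi> w = r * w + (r - 1) * \<beta> / of_real ((cmod c)\<^sup>2 - (cmod d)\<^sup>2))"
      if "(cmod c)\<^sup>2 \<noteq> (cmod d)\<^sup>2"
      by (rule Q_preserving_rotation[OF Q that])
  next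
    fix \<Phi> :: "complex \<Rightarrow> complex" and r :: complex
    assume \<Phi>: "(cmod c)\<^sup>2 = (cmod d)\<^sup>2 \<and> Re (cnj r * \<beta>) = 0 \<and> (\<forall>w\<in>\<Omega>. \<Phi> w = w + r) \<or>
        (cmod c)\<^sup>2 \<noteq> (cmod d)\<^sup>2 \<and> cmod r = 1 \<and>
        (\<forall>w\<in>\<Omega>. \<Phi> w = r * w + (r - 1) * \<beta> / of_real ((cmod c)\<^sup>2 - (cmod d)\<^sup>2))"
      and self: "\<Phi> ` \<Omega> \<subseteq> \<Omega>" and inv: "invertible_operator \<Omega> \<tau> (composition_op \<Omega> \<Phi>)"
    from \<Phi> show "unitary_operator \<Omega> \<tau> s (composition_op \<Omega> \<Phi>)"
    proof (elim disjE conjE)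
      assume "(cmod c)\<^sup>2 = (cmod d)\<^sup>2" "Re (cnj r * \<beta>) = 0" "\<forall>w\<in>\<Omega>. \<Phi> w = w + r"
      then show ?thesis
        by (intro Q_preserving_unitary[where L = "\<lambda>w. w + r", OF Q_translation _ _ self inv]) auto
    next
      define N where "N = (cmod c)\<^sup>2 - (cmod d)\<^sup>2"
      assume cd: "(cmod c)\<^sup>2 \<noteq> (cmod d)\<^sup>2" and r: "cmod r = 1"
        and "\<forall>w\<in>\<Omega>. \<Phi> w = r * w + (r - 1) * \<beta> / of_real ((cmod c)\<^sup>2 - (cmod d)\<^sup>2)"
      then have eq: "\<Phi> w = r * w + (r - 1) * \<beta> / N" if "w \<in> \<Omega>" for w
        using that by (simp add: N_def)
      have N: "N \<noteq> 0" using cd by (simp add: N_def)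
      have "r \<noteq> 0" using r by auto
      then have "surj (\<lambda>w. r * w + (r - 1) * \<beta> / N)"
        by (intro surjI[where f = "\<lambda>w. (w - (r - 1) * \<beta> / N) / r"]) simp
      then show ?thesis
        using Q_preserving_unitary[OF Q_rotation[OF N_def N r] _ eq self inv] by blast
    qed
  qed
qed

end
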